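(* Let $K$ be a field, $n\ge 1$, $S=K[x_1,\ldots,x_n]$, and let $I\subset S$ be a monomial ideal. Then there exists a quasi-linear function $f:\mathbb{Z}\to\mathbb{Z}$ such that $\sigma\big((I^k)^{\mathrm{sat}}/I^k\big)=f(k)$ for all $k\gg 0$.
   Context: $S=K[x_1,\ldots,x_n]$ is standard graded with graded maximal ideal $\mathfrak{m}=(x_1,\ldots,x_n)$. For a graded ideal $J\subset S$, its saturation is $J^{\mathrm{sat}}=\bigcup_{t\ge 0}(J:\mathfrak{m}^t)$; the module $J^{\mathrm{sat}}/J$ has finite length. For a nonzero graded $S$-module $M$ of finite length put $\alpha(M)=\min\{j: M_j\ne 0\}$, $\beta(M)=\max\{j: M_j\neq 0\}$ and $\sigma(M)=\beta(M)-\alpha(M)+1$; put $\sigma(0)=0$. A function $f:\mathbb{Z}\to\mathbb{Z}$ is called quasi-linear if there exist an integer $d\ge 1$ and, for $i=0,\ldots,d-1$, linear functions $f_i(x)=a_ix+b_i$ with $a_i,b_i\in\mathbb{Q}$ such that $f(k)=f_i(k)$ whenever $k\equiv i \bmod d$. *)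

theory Defs
  imports Complex_Main "HOL-Library.Poly_Mapping" "HOL-Library.Set_Algebras" "HOL-Number_Theory.Cong"
begin

text \<open>The polynomial ring over \<open>'k\<close> in variables indexed by the finite type \<open>'n\<close>: finitely
  supported functions from exponent vectors to coefficients, with the convolution product.\<close>

type_synonym ('n, 'k) polyring = "('n \<Rightarrow>\<^sub>0 nat) \<Rightarrow>\<^sub>0 'k"

text \<open>A commutative ring as a module over itself: \<open>ideal.subspace\<close> is "being an ideal" and
  \<open>ideal.span\<close> is "ideal generated by".\<close>

interpretation ideal: module "times :: 'a::comm_ring_1 \<Rightarrow> 'a \<Rightarrow> 'a"
  by standard (simp_all add: algebra_simps)

definition monom_of :: "('n \<Rightarrow>\<^sub>0 nat) \<Rightarrow> ('n, 'k::field) polyring" where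
  "monom_of m = Poly_Mapping.single m 1"

definition var :: "'n \<Rightarrow> ('n, 'k::field) polyring" where
  "var i = monom_of (Poly_Mapping.single i 1)"

definition monomial_ideal :: "('n, 'k::field) polyring set \<Rightarrow> bool" where
  "monomial_ideal I \<longleftrightarrow> (\<exists>M. I = ideal.span (monom_of ` M))"

definition max_ideal :: "('n, 'k::field) polyring set" where
  "max_ideal = ideal.span (range var)"

text \<open>The product of two sets is elementwise (\<open>Set_Algebras\<close>).\<close>

primrec ideal_power :: "'a::comm_ring_1 set \<Rightarrow> nat \<Rightarrow> 'a set" where
  "ideal_power I 0 = UNIV"
| "ideal_power I (Suc k) = ideal.span (ideal_power I k * I)"

definition colon :: "'a::comm_ring_1 set \<Rightarrow> 'a set \<Rightarrow> 'a set" where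
  "colon J L = {f. \<forall>g\<in>L. f * g \<in> J}"

definition saturation :: "('n, 'k::field) polyring set \<Rightarrow> ('n, 'k) polyring set" where
  "saturation J = (\<Union>t. colon J (ideal_power max_ideal t))"

definition total_degree :: "('n::finite \<Rightarrow>\<^sub>0 nat) \<Rightarrow> nat" where
  "total_degree m = (\<Sum>i\<in>UNIV. Poly_Mapping.lookup m i)"

text \<open>The zero polynomial is homogeneous of every degree.\<close>

definition homogeneous :: "nat \<Rightarrow> ('n::finite, 'k::field) polyring \<Rightarrow> bool" where
  "homogeneous j f \<longleftrightarrow> (\<forall>m\<in>Poly_Mapping.keys f. total_degree m = j)"

text \<open>For graded ideals \<open>J \<subseteq> L\<close>, the module \<open>L / J\<close> as a set of cosets, and its component of
  degree \<open>j\<close>. The zero element is the coset \<open>J\<close>. Components of negative degree vanish, so degrees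
  are natural numbers.\<close>

definition quotient_mod :: "'a::comm_ring_1 set \<Rightarrow> 'a set \<Rightarrow> 'a set set" where
  "quotient_mod L J = (\<lambda>f. f +o J) ` L"

definition quotient_component ::
  "('n::finite, 'k::field) polyring set \<Rightarrow> ('n, 'k) polyring set \<Rightarrow> nat \<Rightarrow> ('n, 'k) polyring set set" where
  "quotient_component L J j = (\<lambda>f. f +o J) ` {f \<in> L. homogeneous j f}"

text \<open>The following two are meaningful only if \<open>L / J\<close> is nonzero of finite length, since \<open>Min\<close>
  and \<open>Max\<close> are only specified on finite nonempty sets.\<close>

definition alpha :: "('n::finite, 'k::field) polyring set \<Rightarrow> ('n, 'k) polyring set \<Rightarrow> nat" where
  "alpha L J = Min {j. quotient_component L J j \<noteq> {J}}"

definition beta :: "('n::finite, 'k::field) polyring set \<Rightarrow> ('n, 'k) polyring set \<Rightarrow> nat" where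
  "beta L J = Max {j. quotient_component L J j \<noteq> {J}}"

definition sigma :: "('n::finite, 'k::field) polyring set \<Rightarrow> ('n, 'k) polyring set \<Rightarrow> int" where
  "sigma L J = (if quotient_mod L J = {J} then 0 else int (beta L J) - int (alpha L J) + 1)"

definition quasi_linear :: "(int \<Rightarrow> int) \<Rightarrow> bool" where
  "quasi_linear f \<longleftrightarrow>
    (\<exists>d::nat. d \<ge> 1 \<and> (\<exists>a b :: nat \<Rightarrow> rat. \<forall>i<d. \<forall>k::int.
       [k = int i] (mod int d) \<longrightarrow> of_int (f k) = a i * of_int k + b i))"

end

theory Submission
  imports Defs "HOL-Library.Product_Plus" "HOL-Library.Function_Algebras"
begin

text \<open>A monomial ideal is determined by its upward closed set of exponent vectors. By Dickson's
  lemma \<open>I\<close> has finitely many monomial generators, so membership of an exponent vector in \<open>I\<^sup>k\<close>,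
  and hence in its saturation, is a formula of Presburger arithmetic in \<open>k\<close> and the vector. The graph
  of \<open>k \<mapsto> \<sigma>((I\<^sup>k)\<^sup>s\<^sup>a\<^sup>t / I\<^sup>k)\<close> is therefore Presburger-definable, and a function with such a graph
  is eventually quasi-linear. Presburger definability is treated semantically, by quantifier
  elimination for Boolean combinations of linear inequalities and divisibility conditions on an
  abelian group.\<close>

text \<open>The obstacle is the alternation of quantifiers: the saturation asks for a
  \<open>t\<close> that works for all vectors of degree at least \<open>t\<close>, and the spread
  asks for a least and a greatest degree, so the graph is not visibly the set of lattice points of a
  polyhedron. Definability has to be closed under negation as well as projection. One variable is
  eliminated by Cooper's method: along a line, and up to a period, truth changes only near the
  boundaries of inequality atoms, so a witness may be sought at such a boundary or far out. The
  power \<open>k\<close> can be a variable at all because a product of \<open>k\<close> generators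
  is recorded by its multiplicities, which sum to \<open>k\<close>; the number of unknowns is the
  number of generators and does not grow with \<open>k\<close>. The group is kept arbitrary so that
  a quantified integer, or a whole vector of them, is just one more factor.\<close>

section \<open>Presburger-definable predicates\<close>

text \<open>As a rewrite rule this associates to the left and loops with \<open>algebra_simps\<close>.\<close>

declare ideal.scale_scale [simp del]

section \<open>Atoms, Boolean closure, pullbacks and translates\<close>

text \<open>A variable is a coordinate of the group and a linear form an additive map to the
  integers, so no syntax of terms is needed. The constant \<open>c\<close> supplies the affine part,
  as additive maps vanish at 0.\<close>

inductive presburger :: "('g::ab_group_add \<Rightarrow> bool) \<Rightarrow> bool" where
  le: "additive l \<Longrightarrow> presburger (\<lambda>g. (c::int) \<le> l g)"
| dvd: "additive l \<Longrightarrow> d > 0 \<Longrightarrow> presburger (\<lambda>g. (d::int) dvd l g + c)"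
| neg: "presburger P \<Longrightarrow> presburger (\<lambda>g. \<not> P g)"
| conj: "presburger P \<Longrightarrow> presburger Q \<Longrightarrow> presburger (\<lambda>g. P g \<and> Q g)"

lemma additive_int: "additive l \<Longrightarrow> l x = x * l 1" for l :: "int \<Rightarrow> int"
proof -
  assume "additive l"
  then interpret additive l .
  have "l (int n) = int n * l 1" for n
    by (induction n) (simp_all add: zero add algebra_simps)
  then show ?thesis
    by (cases x rule: int_cases2) (simp_all add: minus)
qed

lemma additive_comp: "additive f \<Longrightarrow> additive g \<Longrightarrow> additive (\<lambda>x. f (g x))"
  by (simp add: additive_def)

text \<open>The map \<open>h\<close> embeds the variable to be eliminated, and
  \<open>l (h 1)\<close> is the slope of \<open>l\<close> in that direction.\<close>

lemma additive_along:
  fixes l :: "'g::ab_group_add \<Rightarrow> int"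
  assumes "additive l" "additive h"
  shows "l (g + h x) = l g + x * l (h 1)"
  using additive_int[OF additive_comp[OF assms], of x] assms(1) by (simp add: additive_def)

lemma additive_scale: "additive l \<Longrightarrow> additive (\<lambda>x. a * l x)" for l :: "'g::ab_group_add \<Rightarrow> int"
  by (simp add: additive_def distrib_left)

lemma additive_minus: "additive f \<Longrightarrow> additive g \<Longrightarrow> additive (\<lambda>x. f x - g x)"
  by (simp add: additive_def algebra_simps)

lemma additive_uminus: "additive f \<Longrightarrow> additive (\<lambda>x. - f x)"
  by (simp add: additive_def algebra_simps)

lemma additive_const_0: "additive (\<lambda>x. 0)"
  by (simp add: additive_def)

lemma presburger_const: "presburger (\<lambda>g. b)"
proof -
  have "presburger (\<lambda>g::'a. 0 \<le> (0::int))" "presburger (\<lambda>g::'a. 1 \<le> (0::int))"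
    by (rule presburger.le[OF additive_const_0])+
  then show ?thesis by (cases b) simp_all
qed

lemma presburger_disj: "presburger P \<Longrightarrow> presburger Q \<Longrightarrow> presburger (\<lambda>g. P g \<or> Q g)"
  using presburger.neg[OF presburger.conj[OF presburger.neg presburger.neg], of P Q] by simp

lemma presburger_imp: "presburger P \<Longrightarrow> presburger Q \<Longrightarrow> presburger (\<lambda>g. P g \<longrightarrow> Q g)"
  unfolding imp_conv_disj by (rule presburger_disj[OF presburger.neg])

lemma presburger_bex:
  assumes "finite A" "\<And>a. a \<in> A \<Longrightarrow> presburger (P a)"
  shows "presburger (\<lambda>g. \<exists>a\<in>A. P a g)"
  using assms by (induction A rule: finite_induct) (simp_all add: presburger_const presburger_disj)

lemma presburger_ball:
  assumes "finite A" "\<And>a. a \<in> A \<Longrightarrow> presburger (P a)"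
  shows "presburger (\<lambda>g. \<forall>a\<in>A. P a g)"
  using assms by (induction A rule: finite_induct) (simp_all add: presburger_const presburger.conj)

lemma presburger_pullback:
  assumes "presburger P" "additive h"
  shows "presburger (\<lambda>g. P (h g))"
  using assms(1)
proof induction
  case (le l c)
  then show ?case using presburger.le[OF additive_comp] assms(2) by blast
next
  case (dvd l d c)
  then show ?case using presburger.dvd[OF additive_comp] assms(2) by blast
qed (simp_all add: presburger.intros)

lemma presburger_translate:
  assumes "presburger P"
  shows "presburger (\<lambda>g. P (g + w))"
  using assms
proof induction
  case (le l c)
  then show ?case
    using presburger.le[OF le, of "c - l w"] by (simp add: additive_def algebra_simps)
next
  case (dvd l d c)
  then show ?case
    using presburger.dvd[OF dvd, of "l w + c"] by (simp add: additive_def algebra_simps)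
qed (simp_all add: presburger.intros)

lemma presburger_le: "additive f \<Longrightarrow> additive g \<Longrightarrow> presburger (\<lambda>x. f x + c \<le> g x)"
  for f g :: "'g::ab_group_add \<Rightarrow> int"
  using presburger.le[OF additive_minus, of g f c] by (simp add: algebra_simps)

lemma presburger_eq: "additive f \<Longrightarrow> additive g \<Longrightarrow> presburger (\<lambda>x. f x = g x + c)"
  for f g :: "'g::ab_group_add \<Rightarrow> int"
  using presburger.conj[OF presburger_le[of f g "-c"] presburger_le[of g f c]]
  by (simp add: algebra_simps eq_iff)

lemma presburger_le_0: "additive f \<Longrightarrow> additive g \<Longrightarrow> presburger (\<lambda>x. f x \<le> g x)"
  for f g :: "'g::ab_group_add \<Rightarrow> int"
  using presburger_le[of f g 0] by simp

lemma presburger_eq_0: "additive f \<Longrightarrow> additive g \<Longrightarrow> presburger (\<lambda>x. f x = g x)"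
  for f g :: "'g::ab_group_add \<Rightarrow> int"
  using presburger_eq[of f g 0] by simp

lemma presburger_all_finite:
  assumes "\<And>i::'i::finite. presburger (P i)"
  shows "presburger (\<lambda>g. \<forall>i. P i g)"
  using presburger_ball[OF finite_UNIV, of P] assms by simp

section \<open>Definable predicates along one direction\<close>

text \<open>\<open>T\<close> lists hyperplanes transversal to \<open>h\<close>; off them a shift by
  \<open>h D\<close> cannot change \<open>P\<close>. Transversality later allows \<open>x\<close> to
  be solved from \<open>l (g + h x) = r\<close>.\<close>

definition threshold_set :: "(int \<Rightarrow> 'g::ab_group_add) \<Rightarrow> ('g \<Rightarrow> bool) \<Rightarrow> int \<Rightarrow> (('g \<Rightarrow> int) \<times> int) set \<Rightarrow> bool"
  where "threshold_set h P D T \<longleftrightarrow> finite T \<and> (\<forall>(l, r)\<in>T. additive l \<and> l (h 1) \<noteq> 0) \<and>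
    (\<forall>g. P g \<noteq> P (g + h D) \<longrightarrow> (\<exists>(l, r)\<in>T. l g = r))"

text \<open>A shift by a suitable \<open>D\<close> in direction \<open>h\<close> preserves the divisibility atoms, so it can
  change the truth value of \<open>P\<close> only within bounded distance of the boundary of some inequality
  atom.\<close>

lemma presburger_threshold:
  fixes h :: "int \<Rightarrow> 'g::ab_group_add"
  assumes "presburger P" "additive h"
  shows "\<exists>D0>0. \<forall>D>0. D0 dvd D \<longrightarrow> (\<exists>T. threshold_set h P D T)"
  using assms(1)
proof induction
  case (le l c)
  have shift: "l (g + h D) = l g + D * l (h 1)" for g D
    using additive_along[OF le assms(2)] .
  show ?case
  proof (intro exI[of _ 1] conjI allI impI)
    fix D :: int
    assume "D > 0"
    let ?m = "\<bar>D * l (h 1)\<bar>"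
    have *: "l g \<in> {c - ?m..c + ?m}" if "(c \<le> l g) \<noteq> (c \<le> l (g + h D))" for g
      using that unfolding shift by auto
    show "\<exists>T. threshold_set h (\<lambda>g. c \<le> l g) D T"
    proof (cases "l (h 1) = 0")
      case True
      then show ?thesis by (intro exI[of _ "{}"]) (simp add: threshold_set_def shift)
    next
      case False
      then show ?thesis
        unfolding threshold_set_def using le *
        by (intro exI[of _ "{l} \<times> {c - ?m..c + ?m}"]) (auto simp del: atLeastAtMost_iff)
    qed
  qed simp
next
  case (dvd l d c)
  have "d dvd l (g + h D) + c \<longleftrightarrow> d dvd l g + c" if "d dvd D" for g D
    using that unfolding additive_along[OF dvd(1) assms(2)]
    by (metis add.assoc add.commute dvd_add_left_iff dvd_mult2)
  then show ?case
    using dvd by (intro exI[of _ d] conjI allI impI exI[of _ "{}"]) (auto simp: threshold_set_def)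
next
  case (neg P)
  then show ?case by (simp add: threshold_set_def)
next
  case (conj P Q)
  obtain D1 where D1: "D1 > 0" "\<And>D. D > 0 \<Longrightarrow> D1 dvd D \<Longrightarrow> \<exists>T. threshold_set h P D T"
    using conj.IH(1) by blast
  obtain D2 where D2: "D2 > 0" "\<And>D. D > 0 \<Longrightarrow> D2 dvd D \<Longrightarrow> \<exists>T. threshold_set h Q D T"
    using conj.IH(2) by blast
  \<comment> \<open>A common multiple suits both conjuncts, which is why the statement admits every
    positive multiple of \<open>D0\<close>.\<close>
  show ?case
  proof (intro exI[of _ "D1 * D2"] conjI allI impI)
    fix D :: int
    assume D: "D > 0" "D1 * D2 dvd D"
    obtain T where T: "threshold_set h P D T"
      using D1(2)[OF D(1) dvd_mult_left[OF D(2)]] by blast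
    obtain T' where T': "threshold_set h Q D T'"
      using D2(2)[OF D(1) dvd_mult_right[OF D(2)]] by blast
    have "\<exists>(l, r)\<in>T \<union> T'. l g = r" if PQ: "(P g \<and> Q g) \<noteq> (P (g + h D) \<and> Q (g + h D))" for g
    proof -
      have "P g \<noteq> P (g + h D) \<or> Q g \<noteq> Q (g + h D)" using PQ by blast
      then have "(\<exists>(l, r)\<in>T. l g = r) \<or> (\<exists>(l, r)\<in>T'. l g = r)"
        using T T' unfolding threshold_set_def by meson
      then show ?thesis by (simp add: bex_Un)
    qed
    moreover have "finite (T \<union> T')" "\<forall>(l, r)\<in>T \<union> T'. additive l \<and> l (h 1) \<noteq> 0"
      using T T' unfolding threshold_set_def by auto
    ultimately show "\<exists>T. threshold_set h (\<lambda>g. P g \<and> Q g) D T"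
      unfolding threshold_set_def by (intro exI[of _ "T \<union> T'"]) blast
  qed (use D1 D2 in simp)
qed

text \<open>The equation has at most one solution \<open>x\<close>, and it has one iff
  \<open>l (h 1)\<close> divides \<open>r - l g\<close>. A quantifier over at most one
  \<open>x\<close> commutes with conjunction and, relative to solvability, with negation, so
  induction over \<open>P\<close> reduces everything to atoms.\<close>

lemma presburger_solve:
  fixes h :: "int \<Rightarrow> 'g::ab_group_add" and l :: "'g \<Rightarrow> int"
  assumes "presburger P" "additive h" "additive l" "l (h 1) \<noteq> 0"
  shows "presburger (\<lambda>g. \<exists>x. l (g + h x) = r \<and> P (g + h x))"
proof -
  define a where "a = l (h 1)"
  have a: "a \<noteq> 0" using assms(4) by (simp add: a_def)
  have pos: "0 < a * a" using a by (simp add: zero_less_mult_iff not_less less_le)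
  have l: "l (g + h x) = r \<longleftrightarrow> a * x = r - l g" for g x
    unfolding additive_along[OF assms(3,2)] by (auto simp: a_def mult.commute)
  have sol: "(\<exists>x. a * x = r - l g) \<longleftrightarrow> \<bar>a\<bar> dvd - l g + r" for g
    unfolding abs_dvd_iff by (auto simp: dvd_def eq_commute)
  have sol_presb: "presburger (\<lambda>g. \<exists>x. a * x = r - l g)"
    unfolding sol using a assms(3) by (intro presburger.dvd additive_uminus) auto
  have uniq: "x = y" if "a * x = r - l g" "a * y = r - l g" for x y g
    using that a by (metis mult_left_cancel)
  show ?thesis
    unfolding l using assms(1)
  proof induction
    case (le l' c)
    let ?b = "l' (h 1)"
    \<comment> \<open>The factor \<open>a * a\<close> is positive whatever the sign of
      \<open>a\<close>, so it preserves the inequality, and it allows \<open>a * x\<close> to be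
      replaced by \<open>r - l g\<close>.\<close>
    have "(\<exists>x. a * x = r - l g \<and> c \<le> l' (g + h x)) \<longleftrightarrow>
        (\<exists>x. a * x = r - l g) \<and> a * a * c - ?b * a * r \<le> (a * a) * l' g - (?b * a) * l g" for g
    proof -
      have "c \<le> l' (g + h x) \<longleftrightarrow> a * a * c - ?b * a * r \<le> (a * a) * l' g - (?b * a) * l g"
        if "a * x = r - l g" for x
      proof -
        have "c \<le> l' (g + h x) \<longleftrightarrow> (a * a) * c \<le> (a * a) * (l' g + x * ?b)"
          unfolding additive_along[OF le assms(2)] by (simp only: mult_le_cancel_left_pos[OF pos])
        also have "(a * a) * (l' g + x * ?b) = (a * a) * l' g + ?b * a * (a * x)"
          by algebra
        finally show ?thesis unfolding that right_diff_distrib by linarith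
      qed
      then show ?thesis by blast
    qed
    then show ?case
      using le assms(3)
      by (simp add: presburger.conj sol_presb presburger.le additive_minus additive_scale)
  next
    case (dvd l' d c)
    let ?b = "l' (h 1)"
    \<comment> \<open>Here one factor \<open>a\<close> is enough; the absolute value keeps the new
      modulus positive, as \<open>presburger.dvd\<close> demands.\<close>
    have "(\<exists>x. a * x = r - l g \<and> d dvd l' (g + h x) + c) \<longleftrightarrow>
        (\<exists>x. a * x = r - l g) \<and> \<bar>a\<bar> * d dvd (a * l' g - ?b * l g) + (?b * r + a * c)" for g
    proof -
      have "d dvd l' (g + h x) + c \<longleftrightarrow> \<bar>a\<bar> * d dvd (a * l' g - ?b * l g) + (?b * r + a * c)"
        if "a * x = r - l g" for x
      proof -
        have "d dvd l' (g + h x) + c \<longleftrightarrow> a * d dvd a * (l' g + x * ?b + c)"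
          unfolding additive_along[OF dvd(1) assms(2)] using a by simp
        also have "a * (l' g + x * ?b + c) = a * l' g + ?b * (a * x) + a * c"
          by algebra
        also have "\<dots> = (a * l' g - ?b * l g) + (?b * r + a * c)"
          unfolding that by algebra
        also have "a * d dvd \<dots> \<longleftrightarrow> \<bar>a\<bar> * d dvd \<dots>"
          by (cases "a > 0") simp_all
        finally show ?thesis .
      qed
      then show ?thesis by blast
    qed
    moreover have "presburger (\<lambda>g. \<bar>a\<bar> * d dvd (a * l' g - ?b * l g) + (?b * r + a * c))"
      using dvd a assms(3) by (intro presburger.dvd additive_minus additive_scale) auto
    ultimately show ?case
      by (simp add: presburger.conj sol_presb)
  next
    case (neg P)
    have "(\<exists>x. a * x = r - l g \<and> \<not> P (g + h x)) \<longleftrightarrow>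
        (\<exists>x. a * x = r - l g) \<and> \<not> (\<exists>x. a * x = r - l g \<and> P (g + h x))" for g
      using uniq by metis
    then show ?case
      using neg.IH by (simp add: presburger.conj sol_presb presburger.neg del: not_ex)
  next
    case (conj P Q)
    have "(\<exists>x. a * x = r - l g \<and> P (g + h x) \<and> Q (g + h x)) \<longleftrightarrow>
        (\<exists>x. a * x = r - l g \<and> P (g + h x)) \<and> (\<exists>x. a * x = r - l g \<and> Q (g + h x))" for g
      using uniq by metis
    then show ?case
      using conj.IH by (simp add: presburger.conj)
  qed
qed

text \<open>For large \<open>x\<close> an inequality atom of nonzero slope is constantly true or
  constantly false, one of zero slope does not depend on \<open>x\<close>, and divisibility atoms
  are periodic. \<open>P'\<close> is \<open>P\<close> with its atoms replaced accordingly: the limit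
  formula of Cooper's method, taken at plus infinity.\<close>

lemma presburger_at_top:
  fixes h :: "int \<Rightarrow> 'g::ab_group_add"
  assumes "presburger P" "additive h"
  shows "\<exists>D0>0. \<exists>P'. presburger P' \<and> (\<forall>g D. D0 dvd D \<longrightarrow> P' (g + h D) = P' g) \<and>
    (\<forall>g. \<forall>\<^sub>F x in at_top. P (g + h x) = P' (g + h x))"
  using assms(1)
proof induction
  case (le l c)
  define a where "a = l (h 1)"
  have along: "l (g + h x) = l g + x * a" for g x
    unfolding a_def by (rule additive_along[OF le assms(2)])
  consider "a = 0" | "a > 0" | "a < 0" by linarith
  then show ?case
  proof cases
    case 1
    then show ?thesis
      using presburger.le[OF le, of c] by (intro exI[of _ 1] conjI exI[of _ "\<lambda>g. c \<le> l g"]) (simp_all add: along)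
  next
    case 2
    have "\<forall>\<^sub>F x in at_top. c \<le> l (g + h x)" for g
      using eventually_ge_at_top[of "max 0 (c - l g)"]
    proof eventually_elim
      case (elim x)
      then have "x * 1 \<le> x * a" using 2 by (intro mult_left_mono) auto
      then show ?case using elim by (simp add: along)
    qed
    then show ?thesis
      by (intro exI[of _ 1] conjI exI[of _ "\<lambda>g. True"]) (simp_all add: presburger_const)
  next
    case 3
    have "\<forall>\<^sub>F x in at_top. \<not> c \<le> l (g + h x)" for g
      using eventually_ge_at_top[of "max 0 (l g - c + 1)"]
    proof eventually_elim
      case (elim x)
      then have "x * a \<le> x * (- 1)" using 3 by (intro mult_left_mono) auto
      then show ?case using elim by (simp add: along)
    qed
    then show ?thesis
      by (intro exI[of _ 1] conjI exI[of _ "\<lambda>g. False"]) (simp_all add: presburger_const)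
  qed
next
  case (dvd l d c)
  have "d dvd l (g + h D) + c \<longleftrightarrow> d dvd l g + c" if "d dvd D" for g D
    using that unfolding additive_along[OF dvd(1) assms(2)]
    by (metis add.assoc add.commute dvd_add_left_iff dvd_mult2)
  then show ?case
    using dvd presburger.dvd[OF dvd, of c]
    by (intro exI[of _ d] conjI exI[of _ "\<lambda>g. d dvd l g + c"]) auto
next
  case (neg P)
  then obtain D0 P' where "D0 > 0" "presburger P'" "\<forall>g D. D0 dvd D \<longrightarrow> P' (g + h D) = P' g"
    "\<forall>g. \<forall>\<^sub>F x in at_top. P (g + h x) = P' (g + h x)" by blast
  then show ?case
    by (intro exI[of _ D0] conjI exI[of _ "\<lambda>g. \<not> P' g"]) (simp_all add: presburger.neg)
next
  case (conj P Q)
  obtain D1 P' where 1: "D1 > 0" "presburger P'" "\<forall>g D. D1 dvd D \<longrightarrow> P' (g + h D) = P' g"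
    "\<forall>g. \<forall>\<^sub>F x in at_top. P (g + h x) = P' (g + h x)" using conj.IH(1) by blast
  obtain D2 Q' where 2: "D2 > 0" "presburger Q'" "\<forall>g D. D2 dvd D \<longrightarrow> Q' (g + h D) = Q' g"
    "\<forall>g. \<forall>\<^sub>F x in at_top. Q (g + h x) = Q' (g + h x)" using conj.IH(2) by blast
  show ?case
  proof (intro exI[of _ "D1 * D2"] conjI exI[of _ "\<lambda>g. P' g \<and> Q' g"] allI impI)
    fix g
    show "\<forall>\<^sub>F x in at_top. (P (g + h x) \<and> Q (g + h x)) = (P' (g + h x) \<and> Q' (g + h x))"
      using 1(4)[rule_format, of g] 2(4)[rule_format, of g] by eventually_elim simp
  next
    fix g D
    assume "D1 * D2 dvd D"
    then show "(P' (g + h D) \<and> Q' (g + h D)) = (P' g \<and> Q' g)"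
      using 1(3) 2(3) dvd_mult_left[of D1 D2 D] dvd_mult_right[of D1 D2 D] by simp
  qed (use 1 2 in \<open>simp_all add: presburger.conj\<close>)
qed

section \<open>Elimination of quantifiers\<close>

text \<open>Start at a solution and step upwards by \<open>D\<close>. Either \<open>P\<close> fails
  at some step, and then the solution just before lies on a hyperplane of \<open>T\<close>; or
  \<open>P\<close> persists, so \<open>P'\<close> holds far out and, by periodicity, at a residue
  below \<open>D\<close>.\<close>

lemma presburger_ex_along:
  fixes h :: "int \<Rightarrow> 'g::ab_group_add"
  assumes P: "presburger P" and h: "additive h"
  shows "presburger (\<lambda>g. \<exists>x. P (g + h x))"
proof -
  obtain D1 where D1: "D1 > 0" "\<And>D. D > 0 \<Longrightarrow> D1 dvd D \<Longrightarrow> \<exists>T. threshold_set h P D T"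
    using presburger_threshold[OF assms] by blast
  obtain D2 P' where P': "D2 > 0" "presburger P'" "\<And>g D. D2 dvd D \<Longrightarrow> P' (g + h D) = P' g"
    "\<And>g. \<forall>\<^sub>F x in at_top. P (g + h x) = P' (g + h x)"
    using presburger_at_top[OF assms] by blast
  \<comment> \<open>This \<open>D\<close> is admissible for the thresholds and at the same time a
    period of \<open>P'\<close>.\<close>
  define D where "D = D1 * D2"
  have D: "D > 0" "D1 dvd D" "D2 dvd D" using D1(1) P'(1) by (auto simp: D_def)
  obtain T where T: "finite T" "\<forall>(l, r)\<in>T. additive l \<and> l (h 1) \<noteq> (0::int)"
    "\<forall>g. P g \<noteq> P (g + h D) \<longrightarrow> (\<exists>(l, r)\<in>T. l g = r)"
    using D1(2)[OF D(1,2)] unfolding threshold_set_def by blast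
  have shift: "g + h (x + y) = g + h x + h y" for g x y
    by (simp add: additive.add[OF h] add.assoc)
  have per: "P' (g + h (x + m * D)) = P' (g + h x)" for g x m
    unfolding shift by (rule P'(3)) (use D(3) in simp)
  \<comment> \<open>Enough steps of length \<open>D\<close> reach the region where \<open>P\<close>
    and \<open>P'\<close> agree, and they leave \<open>P'\<close> unchanged.\<close>
  have far: "\<exists>m\<ge>0. P (g + h (x + m * D)) = P' (g + h x)" for g x
  proof -
    obtain z where z: "\<And>y. y \<ge> z \<Longrightarrow> P (g + h y) = P' (g + h y)"
      using P'(4)[of g] unfolding eventually_at_top_linorder by blast
    define m where "m = max 0 (z - x)"
    have "m * 1 \<le> m * D" using D(1) by (intro mult_left_mono) (auto simp: m_def)
    then have "x + m * D \<ge> z" by (simp add: m_def)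
    then have "P (g + h (x + m * D)) = P' (g + h x)" using z per by simp
    then show ?thesis by (intro exI[of _ m]) (simp add: m_def)
  qed
  have "(\<exists>x. P (g + h x)) \<longleftrightarrow>
    (\<exists>(l, r)\<in>T. \<exists>x. l (g + h x) = r \<and> P (g + h x)) \<or> (\<exists>i\<in>{0..<D}. P' (g + h i))" (is "?L = ?R") for g
  proof
    assume ?L
    then obtain x where x: "P (g + h x)" by blast
    show ?R
    proof (cases "\<exists>(l, r)\<in>T. \<exists>x. l (g + h x) = r \<and> P (g + h x)")
      case False
      have step: "P (g + h (y + D))" if "P (g + h y)" for y
        using T(3)[rule_format, of "g + h y"] False that unfolding shift by blast
      have all: "P (g + h (x + int n * D))" for n
      proof (induction n)
        case (Suc n)
        then show ?case using step[of "x + int n * D"] by (simp add: algebra_simps)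
      qed (simp add: x)
      obtain m where "m \<ge> 0" "P (g + h (x + m * D)) = P' (g + h x)" using far by blast
      then have "P' (g + h x)" using all[of "nat m"] by simp
      then have "P' (g + h (x mod D))"
        using per[of g "x mod D" "x div D"] by simp
      then show ?thesis using D(1) by (intro disjI2 bexI[of _ "x mod D"]) auto
    qed simp
  next
    assume ?R
    then show ?L using far by blast
  qed
  moreover have "presburger (\<lambda>g. \<exists>(l, r)\<in>T. \<exists>x. l (g + h x) = r \<and> P (g + h x))"
    unfolding case_prod_unfold
    using T(1,2) by (intro presburger_bex presburger_solve P h) auto
  moreover have "presburger (\<lambda>g. \<exists>i\<in>{0..<D}. P' (g + h i))"
    by (intro presburger_bex presburger_translate P') simp
  ultimately show ?thesis by (simp add: presburger_disj)
qed

lemma presburger_ex: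
  assumes "presburger (\<lambda>p::int \<times> 'e::ab_group_add. P (fst p) (snd p))"
  shows "presburger (\<lambda>e. \<exists>x. P x e)"
proof -
  have "presburger (\<lambda>g::int \<times> 'e. \<exists>x. P (fst (g + (x, 0))) (snd (g + (x, 0))))"
    by (rule presburger_ex_along[OF assms]) (simp add: additive_def)
  then have "presburger (\<lambda>e::'e. \<exists>x. P (fst ((0, e) + (x, 0))) (snd ((0, e) + (x, 0))))"
    by (rule presburger_pullback) (simp add: additive_def)
  then show ?thesis by simp
qed

lemma presburger_all:
  assumes "presburger (\<lambda>p::int \<times> 'e::ab_group_add. P (fst p) (snd p))"
  shows "presburger (\<lambda>e. \<forall>x. P x e)"
  using presburger.neg[OF presburger_ex[OF presburger.neg[OF assms]]] by simp

text \<open>The index type may be infinite, as for multiplicities indexed by all exponent vectors;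
  support in the finite set \<open>A\<close> leaves finitely many integer unknowns, eliminated one
  by one.\<close>

lemma presburger_ex_fun:
  assumes "finite A" and P: "presburger (\<lambda>p::('v \<Rightarrow> int) \<times> 'e::ab_group_add. P (fst p) (snd p))"
  shows "presburger (\<lambda>e. \<exists>y. (\<forall>v. v \<notin> A \<longrightarrow> y v = 0) \<and> P y e)"
proof -
  let ?S = "\<lambda>A::'v set. {y::'v \<Rightarrow> int. \<forall>v. v \<notin> A \<longrightarrow> y v = 0}"
  \<comment> \<open>Adding \<open>y\<close> to a free first coordinate, instead of substituting it,
    makes the induction on \<open>A\<close> work; that coordinate is set to 0 at the end.\<close>
  have "presburger (\<lambda>p. \<exists>y\<in>?S A. P (fst p + y) (snd p))"
    using assms(1)
  proof induction
    case empty
    have "?S {} = {0}" by auto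
    then show ?case using P by simp
  next
    case (insert v A)
    let ?h = "\<lambda>x::int. (\<lambda>w. if w = v then x else 0, 0::'e)"
    have "presburger (\<lambda>p. \<exists>x. \<exists>y\<in>?S A. P (fst (p + ?h x) + y) (snd (p + ?h x)))"
      using insert.IH by (rule presburger_ex_along) (auto simp: additive_def)
    moreover have "(\<exists>x. \<exists>y\<in>?S A. P (fst (p + ?h x) + y) (snd (p + ?h x))) \<longleftrightarrow>
        (\<exists>y\<in>?S (insert v A). P (fst p + y) (snd p))" for p
    proof
      assume "\<exists>x. \<exists>y\<in>?S A. P (fst (p + ?h x) + y) (snd (p + ?h x))"
      then obtain x y where "y \<in> ?S A" "P (fst (p + ?h x) + y) (snd (p + ?h x))" by blast
      then show "\<exists>y\<in>?S (insert v A). P (fst p + y) (snd p)"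
        by (intro bexI[of _ "fst (?h x) + y"]) (simp_all add: add.assoc)
    next
      assume "\<exists>y\<in>?S (insert v A). P (fst p + y) (snd p)"
      then obtain y where y: "y \<in> ?S (insert v A)" "P (fst p + y) (snd p)" by blast
      have "y = fst (?h (y v)) + y(v := 0)" by auto
      with y(2) have "P (fst (p + ?h (y v)) + y(v := 0)) (snd (p + ?h (y v)))"
        by (simp add: add.assoc)
      moreover have "y(v := 0) \<in> ?S A" using y(1) by auto
      ultimately show "\<exists>x. \<exists>y\<in>?S A. P (fst (p + ?h x) + y) (snd (p + ?h x))" by blast
    qed
    ultimately show ?case by (simp only:)
  qed
  then have "presburger (\<lambda>e. \<exists>y\<in>?S A. P (fst (0::'v \<Rightarrow> int, e) + y) (snd (0::'v \<Rightarrow> int, e)))"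
    by (rule presburger_pullback) (simp add: additive_def)
  then show ?thesis by simp
qed

lemma presburger_ex_fun_UNIV:
  assumes "presburger (\<lambda>p::('v::finite \<Rightarrow> int) \<times> 'e::ab_group_add. P (fst p) (snd p))"
  shows "presburger (\<lambda>e. \<exists>y. P y e)"
  using presburger_ex_fun[OF finite_UNIV assms] by simp

lemma presburger_all_fun_UNIV:
  assumes "presburger (\<lambda>p::('v::finite \<Rightarrow> int) \<times> 'e::ab_group_add. P (fst p) (snd p))"
  shows "presburger (\<lambda>e. \<forall>y. P y e)"
  using presburger.neg[OF presburger_ex_fun_UNIV[OF presburger.neg[OF assms]]] by simp

section \<open>Definable sets of integers and definable functions\<close>

text \<open>This is \<open>presburger_at_top\<close> along the identity of the integers. One period
  for the whole family is needed because all threshold lines of a function are followed at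
  once.\<close>

lemma presburger_eventually_periodic:
  fixes P :: "'a \<Rightarrow> int \<Rightarrow> bool"
  assumes "finite A" "\<And>a. a \<in> A \<Longrightarrow> presburger (P a)"
  shows "\<exists>d>0. \<exists>N. \<forall>a\<in>A. \<forall>x\<ge>N. \<forall>D\<ge>0. d dvd D \<longrightarrow> P a (x + D) = P a x"
  using assms
proof (induction A rule: finite_induct)
  case empty
  show ?case by (intro exI[of _ 1]) simp
next
  case (insert a A)
  obtain d N where d: "d > 0" "\<And>b x D. b \<in> A \<Longrightarrow> x \<ge> N \<Longrightarrow> D \<ge> 0 \<Longrightarrow> d dvd D \<Longrightarrow> P b (x + D) = P b x"
    using insert by blast
  have "additive (\<lambda>x::int. x)" by (simp add: additive_def)
  from presburger_at_top[OF insert.prems[OF insertI1] this]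
  obtain d' P' where d': "d' > 0" "\<And>g D. d' dvd D \<Longrightarrow> P' (g + D) = P' g"
    and ev: "\<forall>\<^sub>F x in at_top. P a (0 + x) = P' (0 + x)" by blast
  from ev obtain N' where N': "\<And>x. x \<ge> N' \<Longrightarrow> P a x = P' x"
    unfolding eventually_at_top_linorder by auto
  have "P b (x + D) = P b x" if "b \<in> insert a A" "x \<ge> max N N'" "D \<ge> 0" "d * d' dvd D" for b x D
  proof (cases "b = a")
    case True
    then show ?thesis using that N'[of x] N'[of "x + D"] d'(2)[OF dvd_mult_right[OF that(4)]] by simp
  next
    case False
    then show ?thesis using that d(2) dvd_mult_left[OF that(4)] by simp
  qed
  then show ?case using d(1) d'(1) by (intro exI[of _ "d * d'"] conjI exI[of _ "max N N'"]) auto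
qed

text \<open>By \<open>presburger_threshold\<close> a definable function takes at each argument the value of one of
  finitely many linear functions, and which one may be chosen periodically.\<close>

lemma presburger_function_quasi_linear:
  fixes s :: "nat \<Rightarrow> int"
  assumes G: "presburger (\<lambda>p. G (fst p) (snd p))"
    and graph: "\<And>k z. G (int k) z \<longleftrightarrow> z = s k"
  shows "\<exists>f. quasi_linear f \<and> (\<forall>\<^sub>F k in sequentially. s k = f (int k))"
proof -
  \<comment> \<open>The direction is that of the value, so each threshold line has a nonzero
    coefficient there and is the graph of a linear function of the argument.\<close>
  let ?h = "\<lambda>x::int. (0::int, x)"
  have "additive ?h" by (simp add: additive_def)
  from presburger_threshold[OF G this] obtain D T
    where D: "D > 0" and T: "threshold_set ?h (\<lambda>p. G (fst p) (snd p)) D T"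
    by (metis dvd_refl)
  have fin: "finite T" using T unfolding threshold_set_def by blast
  have lin: "additive l" "l (0, 1) \<noteq> 0" if "(l, r) \<in> T" for l r
    using T that unfolding threshold_set_def by auto
  \<comment> \<open>\<open>G\<close> holds at the graph point and fails \<open>D\<close> above it,
    because \<open>s k\<close> is the only value.\<close>
  have on_line: "\<exists>(l, r)\<in>T. l (int k, s k) = r" for k
  proof -
    have "G (int k) (s k) \<noteq> G (int k) (s k + D)" using D graph by simp
    then have "G (fst (int k, s k)) (snd (int k, s k)) \<noteq>
      G (fst ((int k, s k) + ?h D)) (snd ((int k, s k) + ?h D))" by simp
    then show ?thesis using T unfolding threshold_set_def by blast
  qed
  \<comment> \<open>\<open>K (l, r)\<close> holds where the graph meets the given line: a definable
    set of integers, hence eventually periodic.\<close>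
  define K where "K = (\<lambda>(l, r) x. \<exists>z. G x z \<and> l (x, z) = (r::int))"
  have K: "presburger (K t)" if "t \<in> T" for t
  proof -
    obtain l r where t: "t = (l, r)" by fastforce
    have l: "additive l" using lin that t by blast
    have "presburger (\<lambda>p::int \<times> int. G (snd p) (fst p) \<and> l (snd p, fst p) = 0 + r)"
    proof (intro presburger.conj)
      show "presburger (\<lambda>p. G (snd p) (fst p))"
        using presburger_pullback[OF G, of "\<lambda>p. (snd p, fst p)"] by (simp add: additive_def)
      show "presburger (\<lambda>p::int \<times> int. l (snd p, fst p) = 0 + r)"
        by (intro presburger_eq additive_comp[OF l] additive_const_0) (simp add: additive_def)
    qed
    then show ?thesis unfolding K_def t using presburger_ex by auto
  qed
  obtain d N where d: "d > 0" and
    per: "\<And>t x D. t \<in> T \<Longrightarrow> x \<ge> N \<Longrightarrow> D \<ge> 0 \<Longrightarrow> d dvd D \<Longrightarrow> K t (x + D) = K t x"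
    using presburger_eventually_periodic[OF fin, where P = K] K by blast
  \<comment> \<open>The offset is a multiple of \<open>d\<close> and at least \<open>N\<close>:
    \<open>base i\<close> keeps the residue of \<open>i\<close> and lies in the periodic range.
    \<open>slope i\<close> is the rise over a full period \<open>d\<close>, so the rational slope is
    \<open>slope i / d\<close>.\<close>
  define base where "base i = nat (\<bar>N\<bar> * d) + i" for i
  define slope where "slope i = s (base i + nat d) - s (base i)" for i
  have base: "int (base i) = \<bar>N\<bar> * d + int i" for i
    using d by (simp add: base_def)
  \<comment> \<open>Pick a line through the first graph point of the progression. Periodicity of
    \<open>K\<close> puts all later graph points on the same line.\<close>
  have progression: "s (base i + m * nat d) = s (base i) + int m * slope i" for i m
  proof -
    obtain l r where t: "(l, r) \<in> T" "l (int (base i), s (base i)) = r"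
      using on_line by blast
    have l: "additive l" "l (0, 1) \<noteq> 0" using lin t by auto
    have "N * 1 \<le> \<bar>N\<bar> * d" using d by (intro mult_mono) auto
    then have N: "int (base i) \<ge> N" by (simp add: base)
    have "K (l, r) (int (base i))" using t graph by (auto simp: K_def)
    then have Km: "K (l, r) (int (base i) + int m * d)" for m
      using per[OF t(1) N, of "int m * d"] d by simp
    have on: "l (int (base i) + int m * d, s (base i + m * nat d)) = r" for m
      using Km[of m] d graph[of "base i + m * nat d"] by (auto simp: K_def)
    have val: "l (x, z) = x * l (1, 0) + z * l (0, 1)" for x z
    proof -
      have "additive (\<lambda>x::int. l (x, 0))" "additive (\<lambda>x::int. l (0, x))"
        by (rule additive_comp[OF l(1)], simp add: additive_def)+
      then have "l (x, 0) = x * l (1, 0)" "l (0, z) = z * l (0, 1)"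
        using additive_int[of "\<lambda>x. l (x, 0)" x] additive_int[of "\<lambda>x. l (0, x)" z] by simp_all
      then show ?thesis using additive.add[OF l(1), of "(x, 0)" "(0, z)"] by simp
    qed
    have "(s (base i + m * nat d) - s (base i)) * l (0, 1) = - int m * d * l (1, 0)" for m
    proof -
      have "(int (base i) + int m * d) * l (1, 0) + s (base i + m * nat d) * l (0, 1) = r"
        using on[of m] by (subst val[symmetric])
      moreover have "int (base i) * l (1, 0) + s (base i) * l (0, 1) = r"
        using t(2) by (subst val[symmetric])
      ultimately show ?thesis unfolding distrib_right left_diff_distrib mult_minus_left by linarith
    qed
    from this[of m] this[of 1]
    have "(s (base i + m * nat d) - s (base i)) * l (0, 1) = (int m * slope i) * l (0, 1)"
      unfolding slope_def by (simp only: mult.assoc mult_1 of_nat_1 mult_minus_left)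
    then show ?thesis using l(2) by simp
  qed
  \<comment> \<open>Each progression is extrapolated to all integers, because quasi-linearity also
    concerns negative arguments. By \<open>f(2)\<close> below the division is exact.\<close>
  define f where "f x = s (base (nat (x mod d))) + (x - int (base (nat (x mod d)))) div d * slope (nat (x mod d))"
    for x
  have f: "f x = s (base i) + (x - int (base i)) div d * slope i" "d dvd x - int (base i)"
    if "[x = int i] (mod d)" "int i < d" for x i
  proof -
    have "x mod d = int i" using that by (simp add: cong_def)
    then show "f x = s (base i) + (x - int (base i)) div d * slope i" by (simp add: f_def)
    have "d dvd x - int i" using that by (simp add: cong_iff_dvd_diff)
    then have "d dvd (x - int i) - \<bar>N\<bar> * d" by simp
    then show "d dvd x - int (base i)" by (simp add: base algebra_simps)
  qed
  have "quasi_linear f"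
    unfolding quasi_linear_def
  proof (rule exI[of _ "nat d"], rule conjI, goal_cases)
    case 2
    show ?case
    proof (rule exI[of _ "\<lambda>i. of_int (slope i) / of_int d"],
      rule exI[of _ "\<lambda>i. of_int (s (base i)) - of_int (int (base i)) * of_int (slope i) / of_int d"],
      intro allI impI)
      fix i k
      assume "i < nat d" "[k = int i] (mod int (nat d))"
      then have ik: "[k = int i] (mod d)" "int i < d" using d by auto
      from f(2)[OF this] obtain q where q: "k - int (base i) = d * q" by blast
      then have "f k = s (base i) + q * slope i" using f(1)[OF ik] d by simp
      then have fk: "(of_int (f k) :: rat) = of_int (s (base i)) + of_int q * of_int (slope i)"
        by (simp only: of_int_add of_int_mult)
      have "k = int (base i) + d * q" using q by simp
      then have k: "(of_int k :: rat) = of_int (int (base i)) + of_int d * of_int q"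
        by (simp only: of_int_add of_int_mult)
      have "(of_int d :: rat) \<noteq> 0" using d by simp
      then have "c / of_int d * (b + of_int d * z) + (w - b * c / of_int d) = w + z * c" for b c w z :: rat
        by (simp add: field_simps)
      then show "(of_int (f k) :: rat) = of_int (slope i) / of_int d * of_int k +
          (of_int (s (base i)) - of_int (int (base i)) * of_int (slope i) / of_int d)"
        unfolding fk k by (rule sym)
    qed
  qed (use d in simp)
  moreover have "\<forall>\<^sub>F k in sequentially. s k = f (int k)"
    \<comment> \<open>This bound exceeds \<open>base i\<close> for every residue
      \<open>i < d\<close>.\<close>
    using eventually_ge_at_top[of "base (nat d)"]
  proof eventually_elim
    case (elim k)
    define i where "i = nat (int k mod d)"
    have i: "[int k = int i] (mod d)" "int i < d"
      using d by (simp_all add: i_def cong_def)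
    from f(2)[OF i] obtain q where q: "int k - int (base i) = d * q" by blast
    have "base i \<le> k" using elim i(2) by (simp add: base_def)
    then have "q \<ge> 0" using q d by (metis of_nat_le_iff diff_ge_0_iff_ge zero_le_mult_iff not_less)
    then have "int k = int (base i + nat q * nat d)" using q d by (simp add: algebra_simps)
    then have k: "k = base i + nat q * nat d" by linarith
    show ?case
      using progression[of i "nat q"] f(1)[OF i] q d \<open>q \<ge> 0\<close> unfolding k[symmetric] by simp
  qed
  ultimately show ?thesis by blast
qed

section \<open>Monomial ideals and exponent sets\<close>

text \<open>The monomial ideals are exactly these sets for upward closed \<open>U\<close>.\<close>

definition supported_in :: "('n \<Rightarrow>\<^sub>0 nat) set \<Rightarrow> ('n, 'k::field) polyring set" where
  "supported_in U = {f. Poly_Mapping.keys f \<subseteq> U}"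

definition up_closed :: "'a::plus set \<Rightarrow> bool" where
  "up_closed U \<longleftrightarrow> (\<forall>m\<in>U. \<forall>v. m + v \<in> U)"

lemma poly_mapping_sum_single:
  "f = (\<Sum>m\<in>Poly_Mapping.keys f. Poly_Mapping.single m (Poly_Mapping.lookup f m))"
proof (rule poly_mapping_eqI)
  fix k
  show "Poly_Mapping.lookup f k =
      Poly_Mapping.lookup (\<Sum>m\<in>Poly_Mapping.keys f. Poly_Mapping.single m (Poly_Mapping.lookup f m)) k"
    by (simp add: lookup_sum lookup_single when_def in_keys_iff)
qed

text \<open>Multiplying by a single term only shifts exponents, so nothing cancels.
  \<open>keys_mult\<close> bounds the support of a product from above only; colon ideals need this
  converse.\<close>

lemma lookup_times_single:
  fixes f :: "('a::cancel_comm_monoid_add) \<Rightarrow>\<^sub>0 ('b::comm_semiring_1)"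
  shows "Poly_Mapping.lookup (f * Poly_Mapping.single v c) (m + v) = Poly_Mapping.lookup f m * c"
proof -
  have "f * Poly_Mapping.single v c =
      (\<Sum>m\<in>Poly_Mapping.keys f. Poly_Mapping.single (m + v) (Poly_Mapping.lookup f m * c))"
    by (subst poly_mapping_sum_single) (simp add: sum_distrib_right mult_single)
  then show ?thesis
    by (simp add: lookup_sum lookup_single when_def in_keys_iff)
qed

lemma subspace_supported_in:
  assumes "up_closed U"
  shows "ideal.subspace (supported_in U :: ('n, 'k::field) polyring set)"
proof (rule ideal.subspaceI)
  fix f g c :: "('n, 'k) polyring"
  assume "f \<in> supported_in U"
  then have f: "Poly_Mapping.keys f \<subseteq> U" by (simp add: supported_in_def)
  have "u \<in> U" if u: "u \<in> Poly_Mapping.keys (f * c)" for u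
  proof -
    obtain a b where "u = a + b" "a \<in> Poly_Mapping.keys f" using keys_mult u by blast
    then show ?thesis using f assms by (auto simp: up_closed_def)
  qed
  then show "c * f \<in> supported_in U" by (auto simp: supported_in_def mult.commute)
  assume "g \<in> supported_in U"
  then show "f + g \<in> supported_in U"
    using f keys_add[of f g] by (auto simp: supported_in_def)
qed (simp add: supported_in_def)

lemma supported_in_subset_subspace:
  fixes S :: "('n, 'k::field) polyring set"
  assumes "ideal.subspace S" "\<And>u c. u \<in> U \<Longrightarrow> Poly_Mapping.single u c \<in> S"
  shows "supported_in U \<subseteq> S"
proof
  fix f :: "('n, 'k) polyring"
  assume "f \<in> supported_in U"
  then have "(\<Sum>m\<in>Poly_Mapping.keys f. Poly_Mapping.single m (Poly_Mapping.lookup f m)) \<in> S"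
    using assms by (intro ideal.subspace_sum) (auto simp: supported_in_def)
  then show "f \<in> S" by (simp flip: poly_mapping_sum_single)
qed

lemma up_closed_plus:
  fixes U V :: "'a::semigroup_add set"
  assumes "up_closed V"
  shows "up_closed (U + V)"
  unfolding up_closed_def
proof (intro ballI allI)
  fix m w
  assume "m \<in> U + V"
  then obtain u v where "m = u + v" "u \<in> U" "v \<in> V" by (rule set_plus_elim)
  then show "m + w \<in> U + V"
    using assms by (simp add: add.assoc set_plus_intro up_closed_def)
qed

lemma up_closed_UNIV: "up_closed UNIV"
  by (simp add: up_closed_def)

lemma span_monom_of:
  "ideal.span (monom_of ` M :: ('n, 'k::field) polyring set) = supported_in (M + UNIV)"
proof
  have "up_closed (M + UNIV)" by (intro up_closed_plus up_closed_UNIV)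
  moreover have "m \<in> M + UNIV" if "m \<in> M" for m
    using set_plus_intro[OF that UNIV_I[of 0]] by simp
  ultimately show "ideal.span (monom_of ` M :: ('n, 'k) polyring set) \<subseteq> supported_in (M + UNIV)"
    by (intro ideal.span_minimal subspace_supported_in) (auto simp: supported_in_def monom_of_def)
  show "supported_in (M + UNIV) \<subseteq> ideal.span (monom_of ` M :: ('n, 'k) polyring set)"
  proof (rule supported_in_subset_subspace[OF ideal.subspace_span])
    fix u and c :: 'k
    assume "u \<in> M + UNIV"
    then obtain m v where u: "u = m + v" "m \<in> M" by (auto elim: set_plus_elim)
    have "Poly_Mapping.single u c = Poly_Mapping.single v c * monom_of m"
      by (simp add: monom_of_def mult_single u add.commute)
    then show "Poly_Mapping.single u c \<in> ideal.span (monom_of ` M)"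
      using u by (simp add: ideal.span_scale ideal.span_base)
  qed
qed

lemma span_times_supported_in:
  assumes "up_closed V"
  shows "ideal.span (supported_in U * supported_in V) = (supported_in (U + V) :: ('n, 'k::field) polyring set)"
proof
  show "ideal.span (supported_in U * supported_in V) \<subseteq> (supported_in (U + V) :: ('n, 'k) polyring set)"
  proof (intro ideal.span_minimal subspace_supported_in up_closed_plus assms subsetI)
    fix h :: "('n, 'k) polyring"
    assume "h \<in> supported_in U * supported_in V"
    then obtain f g where "h = f * g" "f \<in> supported_in U" "g \<in> supported_in V"
      by (auto elim: set_times_elim)
    then show "h \<in> supported_in (U + V)"
      using keys_mult[of f g] by (fastforce simp: supported_in_def intro: set_plus_intro)
  qed
  show "(supported_in (U + V) :: ('n, 'k) polyring set) \<subseteq> ideal.span (supported_in U * supported_in V)"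
  proof (rule supported_in_subset_subspace[OF ideal.subspace_span])
    fix w and c :: 'k
    assume "w \<in> U + V"
    then obtain u v where w: "w = u + v" "u \<in> U" "v \<in> V" by (auto elim: set_plus_elim)
    have "Poly_Mapping.single w c = Poly_Mapping.single u c * Poly_Mapping.single v 1"
      by (simp add: mult_single w)
    also have "\<dots> \<in> supported_in U * supported_in V"
      using w by (intro set_times_intro) (auto simp: supported_in_def)
    finally show "Poly_Mapping.single w c \<in> ideal.span (supported_in U * supported_in V)"
      by (rule ideal.span_base)
  qed
qed

section \<open>Powers, colon ideals and saturation in terms of exponents\<close>

text \<open>The start \<open>UNIV\<close> is the exponent set of the unit ideal and keeps every
  power upward closed.\<close>

primrec exponent_power :: "'a::monoid_add set \<Rightarrow> nat \<Rightarrow> 'a set" where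
  "exponent_power U 0 = UNIV"
| "exponent_power U (Suc k) = exponent_power U k + U"

lemma up_closed_exponent_power: "up_closed U \<Longrightarrow> up_closed (exponent_power U k)"
  by (cases k) (simp_all add: up_closed_UNIV up_closed_plus)

lemma ideal_power_supported_in:
  assumes "up_closed U"
  shows "ideal_power (supported_in U) k = (supported_in (exponent_power U k) :: ('n, 'k::field) polyring set)"
  by (induction k) (simp_all add: span_times_supported_in[OF assms], simp add: supported_in_def)

text \<open>Single terms with exponents in \<open>V\<close> suffice as tests: they shift the support
  without cancellation, so the condition is read off exponent by exponent.\<close>

lemma colon_supported_in:
  "colon (supported_in U) (supported_in V :: ('n, 'k::field) polyring set) =
    supported_in {m. \<forall>v\<in>V. m + v \<in> U}"
proof (intro equalityI subsetI)
  fix f :: "('n, 'k) polyring"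
  assume f: "f \<in> colon (supported_in U) (supported_in V)"
  have "m + v \<in> U" if "m \<in> Poly_Mapping.keys f" "v \<in> V" for m v
  proof -
    have "f * Poly_Mapping.single v 1 \<in> supported_in U"
      using f that(2) by (auto simp: colon_def supported_in_def)
    moreover have "m + v \<in> Poly_Mapping.keys (f * Poly_Mapping.single v 1)"
      using that(1) by (simp add: in_keys_iff lookup_times_single)
    ultimately show ?thesis by (auto simp: supported_in_def)
  qed
  then show "f \<in> supported_in {m. \<forall>v\<in>V. m + v \<in> U}" by (auto simp: supported_in_def)
next
  fix f :: "('n, 'k) polyring"
  assume f: "f \<in> supported_in {m. \<forall>v\<in>V. m + v \<in> U}"
  show "f \<in> colon (supported_in U) (supported_in V)"
    unfolding colon_def
  proof (intro CollectI ballI)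
    fix g :: "('n, 'k) polyring"
    assume "g \<in> supported_in V"
    then show "f * g \<in> supported_in U"
      using f keys_mult[of f g] by (fastforce simp: supported_in_def)
  qed
qed

lemma total_degree_add: "total_degree (m + v) = total_degree m + total_degree v"
  by (simp add: total_degree_def lookup_add sum.distrib)

lemma total_degree_single: "total_degree (Poly_Mapping.single i c) = c"
  by (simp add: total_degree_def lookup_single when_def)

lemma pointwise_le_imp_add:
  fixes a b :: "'a \<Rightarrow>\<^sub>0 nat"
  assumes "\<And>i. Poly_Mapping.lookup a i \<le> Poly_Mapping.lookup b i"
  shows "b = a + (b - a)"
  using assms by (intro poly_mapping_eqI) (simp add: lookup_add lookup_minus)

lemma total_degree_pos_imp_variable:
  assumes "total_degree m > 0"
  shows "\<exists>i v. m = Poly_Mapping.single i 1 + v"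
proof -
  obtain i where "Poly_Mapping.lookup m i \<noteq> 0"
    using assms unfolding total_degree_def by (metis less_irrefl sum.neutral)
  then have "m = Poly_Mapping.single i 1 + (m - Poly_Mapping.single i 1)"
    by (intro pointwise_le_imp_add) (auto simp: lookup_single when_def)
  then show ?thesis by blast
qed

lemma max_ideal_eq: "(max_ideal :: ('n::finite, 'k::field) polyring set) = supported_in {m. 0 < total_degree m}"
proof -
  have "range (\<lambda>i. Poly_Mapping.single i (1::nat)) + UNIV = {m::'n \<Rightarrow>\<^sub>0 nat. 0 < total_degree m}"
  proof (intro equalityI subsetI)
    fix m :: "'n \<Rightarrow>\<^sub>0 nat"
    assume "m \<in> {m. 0 < total_degree m}"
    then obtain i v where m: "m = Poly_Mapping.single i 1 + v"
      using total_degree_pos_imp_variable by blast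
    show "m \<in> range (\<lambda>i. Poly_Mapping.single i 1) + UNIV"
      unfolding m by (rule set_plus_intro) simp_all
  qed (auto elim!: set_plus_elim simp: total_degree_add total_degree_single)
  moreover have "range var = (monom_of ` range (\<lambda>i. Poly_Mapping.single i 1) :: ('n, 'k) polyring set)"
    by (auto simp: var_def)
  ultimately show ?thesis by (simp add: max_ideal_def span_monom_of)
qed

lemma exponent_power_degree:
  "exponent_power {m::'n::finite \<Rightarrow>\<^sub>0 nat. 0 < total_degree m} t = {m. t \<le> total_degree m}"
proof (induction t)
  case (Suc t)
  have "{m. t \<le> total_degree m} + {m. 0 < total_degree m} = {m::'n \<Rightarrow>\<^sub>0 nat. Suc t \<le> total_degree m}"
  proof (intro equalityI subsetI)
    fix m :: "'n \<Rightarrow>\<^sub>0 nat"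
    assume "m \<in> {m. Suc t \<le> total_degree m}"
    then have m: "Suc t \<le> total_degree m" by simp
    then obtain i v where v: "m = Poly_Mapping.single i 1 + v"
      using total_degree_pos_imp_variable[of m] by auto
    then have "m = v + Poly_Mapping.single i 1" by (simp add: add.commute)
    moreover have "t \<le> total_degree v"
      using m by (simp add: v total_degree_add total_degree_single)
    ultimately show "m \<in> {m. t \<le> total_degree m} + {m. 0 < total_degree m}"
      by (simp add: set_plus_intro total_degree_single)
  qed (auto elim!: set_plus_elim simp: total_degree_add)
  then show ?case by (simp add: Suc)
qed simp

text \<open>The vectors of total degree at least \<open>t\<close> are the exponents of the
  \<open>t\<close>-th power of the maximal ideal, by \<open>exponent_power_degree\<close>.\<close>

definition exponent_saturation :: "('n::finite \<Rightarrow>\<^sub>0 nat) set \<Rightarrow> ('n \<Rightarrow>\<^sub>0 nat) set" where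
  "exponent_saturation U = {m. \<exists>t. \<forall>v. t \<le> total_degree v \<longrightarrow> m + v \<in> U}"

text \<open>A polynomial has finitely many exponents, so a single \<open>t\<close> serves all of
  them and the union over \<open>t\<close> moves inside \<open>supported_in\<close>.\<close>

lemma saturation_supported_in:
  "saturation (supported_in U) = (supported_in (exponent_saturation U) :: ('n::finite, 'k::field) polyring set)"
proof -
  let ?U = "\<lambda>t. {m::'n \<Rightarrow>\<^sub>0 nat. \<forall>v. t \<le> total_degree v \<longrightarrow> m + v \<in> U}"
  have "up_closed {m::'n \<Rightarrow>\<^sub>0 nat. 0 < total_degree m}"
    by (simp add: up_closed_def total_degree_add)
  then have sat: "saturation (supported_in U) = (\<Union>t. supported_in (?U t) :: ('n, 'k) polyring set)"
    by (simp add: saturation_def max_ideal_eq ideal_power_supported_in exponent_power_degree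
        colon_supported_in)
  show ?thesis unfolding sat
  proof (intro equalityI subsetI)
    fix f :: "('n, 'k) polyring"
    assume f: "f \<in> supported_in (exponent_saturation U)"
    then have ex: "\<forall>m\<in>Poly_Mapping.keys f. \<exists>t. m \<in> ?U t"
      by (auto simp: supported_in_def exponent_saturation_def)
    obtain t where t: "\<forall>m\<in>Poly_Mapping.keys f. m \<in> ?U (t m)"
      using bchoice[OF ex] by blast
    \<comment> \<open>The condition weakens as \<open>t\<close> grows, so the sum of the individual
      bounds works for every exponent.\<close>
    have "m \<in> ?U (\<Sum>m\<in>Poly_Mapping.keys f. t m)" if "m \<in> Poly_Mapping.keys f" for m
      using bspec[OF t that] member_le_sum[OF that, of t] by (auto intro: order_trans)
    then show "f \<in> (\<Union>t. supported_in (?U t))" by (auto simp: supported_in_def)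
  qed (auto simp: supported_in_def exponent_saturation_def)
qed

section \<open>Degrees of the quotient module\<close>

lemma elt_set_plus_subspace: "ideal.subspace J \<Longrightarrow> f +o J = J \<longleftrightarrow> f \<in> J"
  for J :: "'a::comm_ring_1 set"
proof
  assume J: "ideal.subspace J"
  show "f \<in> J" if "f +o J = J"
    using that ideal.subspace_0[OF J] by (metis add.right_neutral set_plus_intro2)
  show "f +o J = J" if "f \<in> J"
  proof (intro equalityI subsetI)
    fix x
    assume "x \<in> f +o J"
    then show "x \<in> J" using ideal.subspace_add[OF J that] by (auto simp: elt_set_plus_def)
  next
    fix x
    assume "x \<in> J"
    then show "x \<in> f +o J"
      using ideal.subspace_diff[OF J _ that] by (simp add: set_minus_plus[symmetric])
  qed
qed

text \<open>Nonvanishing in degree \<open>j\<close> is always witnessed by a monomial, whose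
  exponent then lies in \<open>L - J\<close>. Hence \<open>alpha\<close> and \<open>beta\<close> are
  the \<open>Min\<close> and \<open>Max\<close> of \<open>E\<close>.\<close>

lemma sigma_supported_in:
  fixes L J :: "('n::finite \<Rightarrow>\<^sub>0 nat) set"
  assumes "up_closed J"
  defines "E \<equiv> total_degree ` (L - J)"
  shows "sigma (supported_in L) (supported_in J :: ('n, 'k::field) polyring set) =
    (if E = {} then 0 else int (Max E) - int (Min E) + 1)"
proof -
  let ?L = "supported_in L :: ('n, 'k) polyring set" and ?J = "supported_in J :: ('n, 'k) polyring set"
  have coset: "f +o ?J = ?J \<longleftrightarrow> f \<in> ?J" for f
    by (intro elt_set_plus_subspace subspace_supported_in assms)
  have zero: "0 \<in> ?L" "homogeneous j (0 :: ('n, 'k) polyring)" for j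
    by (simp_all add: supported_in_def homogeneous_def)
  have image: "(\<lambda>f. f +o ?J) ` F = {?J} \<longleftrightarrow> F \<subseteq> ?J" if "0 \<in> F" for F
    using that coset by (auto simp: image_def)
  have "?L \<subseteq> ?J \<longleftrightarrow> L \<subseteq> J"
  proof
    assume sub: "?L \<subseteq> ?J"
    show "L \<subseteq> J"
    proof
      fix m
      assume "m \<in> L"
      then have "monom_of m \<in> ?L" by (simp add: supported_in_def monom_of_def)
      then have "monom_of m \<in> ?J" using sub by blast
      then show "m \<in> J" by (simp add: supported_in_def monom_of_def)
    qed
  qed (auto simp: supported_in_def)
  then have empty: "quotient_mod ?L ?J = {?J} \<longleftrightarrow> E = {}"
    unfolding quotient_mod_def by (subst image[OF zero(1)]) (auto simp: E_def)
  have "{f \<in> ?L. homogeneous j f} \<subseteq> ?J \<longleftrightarrow> j \<notin> E" for j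
  proof
    assume sub: "{f \<in> ?L. homogeneous j f} \<subseteq> ?J"
    show "j \<notin> E"
    proof
      assume "j \<in> E"
      then obtain m where m: "m \<in> L" "m \<notin> J" "total_degree m = j" by (auto simp: E_def)
      then have "monom_of m \<in> {f \<in> ?L. homogeneous j f}"
        by (simp add: supported_in_def homogeneous_def monom_of_def)
      then have "monom_of m \<in> ?J" using sub by blast
      then show False using m by (simp add: supported_in_def monom_of_def)
    qed
  next
    assume "j \<notin> E"
    then show "{f \<in> ?L. homogeneous j f} \<subseteq> ?J"
      by (auto simp: E_def supported_in_def homogeneous_def)
  qed
  then have "{j. quotient_component ?L ?J j \<noteq> {?J}} = E"
    unfolding quotient_component_def using zero by (subst image) auto
  then show ?thesis unfolding sigma_def empty alpha_def beta_def by simp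
qed

section \<open>Dickson's lemma and finiteness of the degrees\<close>

lemma incseq_subseq_nat:
  fixes s :: "nat \<Rightarrow> nat"
  shows "\<exists>r. strict_mono r \<and> incseq (\<lambda>n. s (r n))"
proof -
  obtain r where r: "strict_mono r" "monoseq (\<lambda>n. s (r n))" using seq_monosub by blast
  show ?thesis
  proof (cases "incseq (\<lambda>n. s (r n))")
    case False
    then have dec: "decseq (\<lambda>n. s (r n))" using r(2) by (simp add: monoseq_iff)
    \<comment> \<open>A decreasing sequence is constant from an index on at which it takes its least
      value.\<close>
    obtain N where N: "\<And>n. s (r N) \<le> s (r n)"
      using ex_has_least_nat[of "\<lambda>_. True" _ "\<lambda>n. s (r n)"] by blast
    have "s (r (N + n)) = s (r N)" for n
      using N decseqD[OF dec, of N "N + n"] by (simp add: antisym)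
    then have "incseq (\<lambda>n. s (r (N + n)))" by (simp add: incseq_def)
    moreover have "strict_mono (\<lambda>n. r (N + n))" using r(1) by (simp add: strict_mono_def)
    ultimately show ?thesis by blast
  qed (use r in blast)
qed

lemma incseq_subseq_fun:
  fixes s :: "nat \<Rightarrow> 'a \<Rightarrow> nat"
  assumes "finite A"
  shows "\<exists>r. strict_mono r \<and> (\<forall>i\<in>A. incseq (\<lambda>n. s (r n) i))"
  using assms
proof induction
  case empty
  show ?case using strict_mono_id by blast
next
  case (insert i A)
  then obtain r where r: "strict_mono r" "\<And>j. j \<in> A \<Longrightarrow> incseq (\<lambda>n. s (r n) j)" by blast
  obtain q where q: "strict_mono q" "incseq (\<lambda>n. s (r (q n)) i)"
    using incseq_subseq_nat[of "\<lambda>n. s (r n) i"] by blast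
  have "incseq (\<lambda>n. s (r (q n)) j)" if "j \<in> A" for j
    using r(2)[OF that] strict_mono_mono[OF q(1)] by (simp add: incseq_def mono_def)
  then show ?case using q strict_mono_o[OF r(1) q(1)]
    by (intro exI[of _ "r \<circ> q"]) (auto simp del: strict_mono_o simp: o_def)
qed

text \<open>\<open>B\<close> consists of the elements minimal for divisibility. They form an
  antichain, whereas every sequence of exponent vectors has a coordinatewise increasing subsequence.
  Descent on the total degree leads from any element to a minimal one below it.\<close>

lemma dickson:
  fixes M :: "('n::finite \<Rightarrow>\<^sub>0 nat) set"
  shows "\<exists>B\<subseteq>M. finite B \<and> M \<subseteq> B + UNIV"
proof (intro exI conjI)
  let ?B = "{b \<in> M. \<forall>a\<in>M. \<forall>v. b = a + v \<longrightarrow> a = b}"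
  show "?B \<subseteq> M" by blast
  show "finite ?B"
  proof (rule ccontr)
    assume "infinite ?B"
    then obtain s :: "nat \<Rightarrow> 'n \<Rightarrow>\<^sub>0 nat" where s: "inj s" "range s \<subseteq> ?B"
      using infinite_countable_subset by blast
    obtain r where r: "strict_mono r" "\<And>i. incseq (\<lambda>n. Poly_Mapping.lookup (s (r n)) i)"
      using incseq_subseq_fun[OF finite_UNIV, of "\<lambda>n. Poly_Mapping.lookup (s n)"] by auto
    have "s (r 1) = s (r 0) + (s (r 1) - s (r 0))"
      using r(2) by (intro pointwise_le_imp_add) (meson incseqD zero_le_one)
    then have "s (r 0) = s (r 1)" using s(2) by blast
    then show False using s(1) r(1) by (metis injD strict_mono_eq zero_neq_one)
  qed
  show "M \<subseteq> ?B + UNIV"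
  proof
    fix m
    assume "m \<in> M"
    then show "m \<in> ?B + UNIV"
    proof (induction "total_degree m" arbitrary: m rule: less_induct)
      case less
      show ?case
      proof (cases "m \<in> ?B")
        case True
        then show ?thesis using set_plus_intro[OF True UNIV_I[of 0]] by simp
      next
        case False
        then obtain a v where a: "a \<in> M" "m = a + v" "a \<noteq> m" using less.prems by blast
        then have "v \<noteq> 0" by auto
        then obtain i where "Poly_Mapping.lookup v i \<noteq> 0" by (metis lookup_zero poly_mapping_eqI)
        then have "total_degree v > 0"
          by (auto simp: total_degree_def intro!: sum_pos2[where i = i])
        then have "a \<in> ?B + UNIV" using less.hyps a by (simp add: total_degree_add)
        then obtain b w where "b \<in> ?B" "a = b + w" by (rule set_plus_elim)
        then show ?thesis using a(2) set_plus_intro[of b ?B "w + v" UNIV] by (simp add: add.assoc)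
      qed
    qed
  qed
qed

lemma up_closed_finite_basis:
  assumes "up_closed (U :: ('n::finite \<Rightarrow>\<^sub>0 nat) set)"
  shows "\<exists>B. finite B \<and> U = B + UNIV"
proof -
  obtain B where "B \<subseteq> U" "finite B" "U \<subseteq> B + UNIV" using dickson by blast
  moreover from this have "B + UNIV \<subseteq> U" using assms by (auto simp: up_closed_def set_plus_def)
  ultimately show ?thesis by blast
qed

text \<open>This makes \<open>Min\<close> and \<open>Max\<close> of the degrees meaningful. An
  element of the saturation is \<open>b + v\<close> with \<open>b\<close> from a finite basis, and
  it lies in \<open>U\<close> as soon as the degree of \<open>v\<close> reaches a bound
  \<open>t b\<close>.\<close>

lemma finite_degrees_saturation:
  fixes U :: "('n::finite \<Rightarrow>\<^sub>0 nat) set"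
  assumes "up_closed U"
  shows "finite (total_degree ` (exponent_saturation U - U))"
proof -
  have "up_closed (exponent_saturation U)"
    unfolding up_closed_def
  proof (intro ballI allI)
    fix m w
    assume "m \<in> exponent_saturation U"
    then obtain t where "\<And>v. t \<le> total_degree v \<Longrightarrow> m + v \<in> U"
      by (auto simp: exponent_saturation_def)
    then have "m + w + v \<in> U" if "t \<le> total_degree v" for v
      using that by (simp add: add.assoc total_degree_add)
    then show "m + w \<in> exponent_saturation U" by (auto simp: exponent_saturation_def)
  qed
  then obtain B where B: "finite B" "exponent_saturation U = B + UNIV"
    using up_closed_finite_basis by blast
  have "B \<subseteq> exponent_saturation U"
    using set_zero_plus2[of UNIV B] B(2) by (simp add: add.commute)
  then have "\<forall>b\<in>B. \<exists>t. \<forall>v. t \<le> total_degree v \<longrightarrow> b + v \<in> U"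
    by (auto simp: exponent_saturation_def)
  then obtain t where t: "\<And>b v. b \<in> B \<Longrightarrow> t b \<le> total_degree v \<Longrightarrow> b + v \<in> U" by metis
  have "total_degree m < (\<Sum>b\<in>B. total_degree b + t b)" if m: "m \<in> exponent_saturation U - U" for m
  proof -
    obtain b v where bv: "b \<in> B" "m = b + v" using m B(2) by (auto elim: set_plus_elim)
    then have "total_degree v < t b" using t m by force
    then have "total_degree m < total_degree b + t b" by (simp add: bv total_degree_add)
    also have "\<dots> \<le> (\<Sum>b\<in>B. total_degree b + t b)"
      using bv(1) B(1) by (intro member_le_sum) auto
    finally show ?thesis .
  qed
  then show ?thesis by (intro finite_subset[OF _ finite_lessThan]) auto
qed

section \<open>Powers described by multiplicities of generators\<close>

text \<open>The exponents of a power are those above a sum of \<open>k\<close> generators, and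
  \<open>c\<close> counts how often each generator occurs. The recursion on \<open>k\<close> thus
  becomes a linear system in which \<open>k\<close> is an ordinary unknown.\<close>

lemma exponent_power_iff:
  fixes B :: "('n \<Rightarrow>\<^sub>0 nat) set"
  assumes "finite B"
  shows "u \<in> exponent_power (B + UNIV) k \<longleftrightarrow>
    (\<exists>c. (\<Sum>a\<in>B. c a) = k \<and> (\<forall>i. (\<Sum>a\<in>B. c a * Poly_Mapping.lookup a i) \<le> Poly_Mapping.lookup u i))"
proof (induction k arbitrary: u)
  case 0
  show ?case by (auto intro: exI[of _ "\<lambda>_. 0"])
next
  case (Suc k)
  have sum_upd: "(\<Sum>a\<in>B. (c(b := Suc (c b))) a * g a) = (\<Sum>a\<in>B. c a * g a) + g b"
    if "b \<in> B" for b c and g :: "('n \<Rightarrow>\<^sub>0 nat) \<Rightarrow> nat"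
    using sum.remove[OF assms that, of "\<lambda>a. (c(b := Suc (c b))) a * g a"]
      sum.remove[OF assms that, of "\<lambda>a. c a * g a"] by simp
  show ?case
  proof
    assume "u \<in> exponent_power (B + UNIV) (Suc k)"
    then obtain w b v where u: "u = w + (b + v)" "w \<in> exponent_power (B + UNIV) k" "b \<in> B"
      by (auto elim!: set_plus_elim)
    then obtain c where c: "(\<Sum>a\<in>B. c a) = k"
      "\<And>i. (\<Sum>a\<in>B. c a * Poly_Mapping.lookup a i) \<le> Poly_Mapping.lookup w i"
      using Suc by blast
    show "\<exists>c. (\<Sum>a\<in>B. c a) = Suc k \<and>
        (\<forall>i. (\<Sum>a\<in>B. c a * Poly_Mapping.lookup a i) \<le> Poly_Mapping.lookup u i)"
    proof (intro exI[of _ "c(b := Suc (c b))"] conjI allI)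
      show "(\<Sum>a\<in>B. (c(b := Suc (c b))) a) = Suc k"
        using sum_upd[OF u(3), of c "\<lambda>_. 1"] c(1) by simp
      show "(\<Sum>a\<in>B. (c(b := Suc (c b))) a * Poly_Mapping.lookup a i) \<le> Poly_Mapping.lookup u i" for i
        using sum_upd[OF u(3), of c "\<lambda>a. Poly_Mapping.lookup a i"] c(2)[of i]
        by (simp add: u(1) lookup_add del: fun_upd_apply)
    qed
  next
    assume "\<exists>c. (\<Sum>a\<in>B. c a) = Suc k \<and>
        (\<forall>i. (\<Sum>a\<in>B. c a * Poly_Mapping.lookup a i) \<le> Poly_Mapping.lookup u i)"
    then obtain c where c: "(\<Sum>a\<in>B. c a) = Suc k"
      "\<And>i. (\<Sum>a\<in>B. c a * Poly_Mapping.lookup a i) \<le> Poly_Mapping.lookup u i" by blast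
    \<comment> \<open>As the multiplicities sum to a positive number, some generator occurs and can
      be split off.\<close>
    then obtain b where b: "b \<in> B" "c b \<noteq> 0" by (metis nat.distinct(1) sum.neutral)
    define c' where "c' = c(b := c b - 1)"
    have c': "c = c'(b := Suc (c' b))" using b(2) by (auto simp: c'_def)
    have sum': "(\<Sum>a\<in>B. c a * g a) = (\<Sum>a\<in>B. c' a * g a) + g b" for g
      by (subst c') (rule sum_upd[OF b(1)])
    have u: "u = b + (u - b)"
      using c(2) sum' by (intro pointwise_le_imp_add) (metis add_leE)
    have "u - b \<in> exponent_power (B + UNIV) k"
      unfolding Suc
    proof (intro exI[of _ c'] conjI allI)
      show "(\<Sum>a\<in>B. c' a) = k" using sum'[of "\<lambda>_. 1"] c(1) by simp
      show "(\<Sum>a\<in>B. c' a * Poly_Mapping.lookup a i) \<le> Poly_Mapping.lookup (u - b) i" for i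
        using c(2)[of i] sum'[of "\<lambda>a. Poly_Mapping.lookup a i"] by (simp add: lookup_minus)
    qed
    moreover have "b \<in> B + UNIV" using set_plus_intro[OF b(1) UNIV_I[of 0]] by simp
    ultimately have "(u - b) + b \<in> exponent_power (B + UNIV) (Suc k)"
      by (simp add: set_plus_intro)
    then show "u \<in> exponent_power (B + UNIV) (Suc k)" using u by (simp add: add.commute)
  qed
qed

section \<open>Definability of the degrees\<close>

text \<open>Definability is stated over groups, so nonnegativity is spelled out. The vanishing of
  \<open>c\<close> outside \<open>B\<close> gives the form required by
  \<open>presburger_ex_fun\<close>.\<close>

definition exponent_power_int :: "('n \<Rightarrow>\<^sub>0 nat) set \<Rightarrow> int \<Rightarrow> ('n \<Rightarrow> int) \<Rightarrow> bool" where
  "exponent_power_int B k u \<longleftrightarrow> (\<exists>c. (\<forall>a. a \<notin> B \<longrightarrow> c a = 0) \<and> (\<forall>a\<in>B. 0 \<le> c a) \<and> (\<Sum>a\<in>B. c a) = k \<and>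
    (\<forall>i. (\<Sum>a\<in>B. c a * int (Poly_Mapping.lookup a i)) \<le> u i))"

text \<open>The last block is \<open>exponent_saturation\<close>, with \<open>t\<close> ranging over
  all integers; a negative bound amounts to the bound 0.\<close>

definition saturation_degree_int :: "('n::finite \<Rightarrow>\<^sub>0 nat) set \<Rightarrow> int \<Rightarrow> int \<Rightarrow> bool" where
  "saturation_degree_int B k j \<longleftrightarrow> (\<exists>u. (\<forall>i. 0 \<le> u i) \<and> (\<Sum>i\<in>UNIV. u i) = j \<and> \<not> exponent_power_int B k u \<and>
    (\<exists>t. \<forall>v. (\<forall>i. 0 \<le> v i) \<and> t \<le> (\<Sum>i\<in>UNIV. v i) \<longrightarrow> exponent_power_int B k (u + v)))"

lemma presburger_exponent_power_int:
  fixes B :: "('n::finite \<Rightarrow>\<^sub>0 nat) set"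
  assumes "finite B"
  shows "presburger (\<lambda>e. exponent_power_int B (fst e) (snd e))"
  unfolding exponent_power_int_def
  by (intro presburger_ex_fun[OF assms] presburger.conj presburger_ball[OF assms] presburger_all_finite
      presburger.le presburger_le_0 presburger_eq_0)
    (simp_all add: additive_def sum.distrib algebra_simps)

lemma presburger_saturation_degree_int:
  fixes B :: "('n::finite \<Rightarrow>\<^sub>0 nat) set"
  assumes "finite B"
  shows "presburger (\<lambda>e. saturation_degree_int B (fst e) (snd e))"
proof -
  \<comment> \<open>Membership occurs at \<open>u\<close> and at \<open>u + v\<close> under
    different quantifiers; pullback along additive arguments covers both.\<close>
  have mem: "presburger (\<lambda>e. exponent_power_int B (f e) (g e))" if "additive f" "additive g"
    for f :: "'e::ab_group_add \<Rightarrow> int" and g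
    using presburger_pullback[OF presburger_exponent_power_int[OF assms], of "\<lambda>e. (f e, g e)"] that
    by (simp add: additive_def)
  show ?thesis
    unfolding saturation_degree_int_def
    by (intro presburger_ex_fun_UNIV presburger.conj presburger_ex presburger_all_fun_UNIV presburger_imp
        presburger_all_finite mem presburger.le presburger_le_0 presburger_eq_0 presburger.neg)
      (simp_all add: additive_def sum.distrib algebra_simps)
qed

section \<open>Agreement of the integer formulas with the exponent sets\<close>

lemma nonneg_vector_exponent:
  fixes u :: "'n::finite \<Rightarrow> int"
  assumes "\<forall>i. 0 \<le> u i"
  obtains m where "u = (\<lambda>i. int (Poly_Mapping.lookup m i))"
proof
  show "u = (\<lambda>i. int (Poly_Mapping.lookup (Abs_poly_mapping (\<lambda>i. nat (u i))) i))"
    using assms by (simp add: lookup_Abs_poly_mapping)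
qed

lemma int_total_degree: "(\<Sum>i\<in>UNIV. int (Poly_Mapping.lookup m i)) = int (total_degree m)"
  by (simp add: total_degree_def)

lemma exponent_power_int_iff:
  assumes "finite B"
  shows "exponent_power_int B (int k) (\<lambda>i. int (Poly_Mapping.lookup u i)) \<longleftrightarrow>
    u \<in> exponent_power (B + UNIV) k"
proof
  assume "exponent_power_int B (int k) (\<lambda>i. int (Poly_Mapping.lookup u i))"
  then obtain c where c: "\<And>a. a \<in> B \<Longrightarrow> 0 \<le> c a" "(\<Sum>a\<in>B. c a) = int k"
    "\<And>i. (\<Sum>a\<in>B. c a * int (Poly_Mapping.lookup a i)) \<le> int (Poly_Mapping.lookup u i)"
    unfolding exponent_power_int_def by blast
  have "int (\<Sum>a\<in>B. nat (c a)) = int k" using c(1,2) by simp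
  moreover have "int (\<Sum>a\<in>B. nat (c a) * Poly_Mapping.lookup a i) \<le> int (Poly_Mapping.lookup u i)" for i
    using c(1) c(3)[of i] by simp
  ultimately show "u \<in> exponent_power (B + UNIV) k"
    unfolding exponent_power_iff[OF assms] of_nat_eq_iff of_nat_le_iff by blast
next
  assume "u \<in> exponent_power (B + UNIV) k"
  then obtain c where c: "(\<Sum>a\<in>B. c a) = k"
    "\<And>i. (\<Sum>a\<in>B. c a * Poly_Mapping.lookup a i) \<le> Poly_Mapping.lookup u i"
    unfolding exponent_power_iff[OF assms] by blast
  show "exponent_power_int B (int k) (\<lambda>i. int (Poly_Mapping.lookup u i))"
    unfolding exponent_power_int_def
  proof (intro exI[of _ "\<lambda>a. if a \<in> B then int (c a) else 0"] conjI allI impI ballI)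
    show "(\<Sum>a\<in>B. if a \<in> B then int (c a) else 0) = int k"
      using c(1) by (simp flip: of_nat_sum)
    show "(\<Sum>a\<in>B. (if a \<in> B then int (c a) else 0) * int (Poly_Mapping.lookup a i))
        \<le> int (Poly_Mapping.lookup u i)" for i
      using c(2)[of i] by (simp flip: of_nat_sum of_nat_mult)
  qed simp_all
qed

lemma saturation_degree_int_iff:
  fixes B :: "('n::finite \<Rightarrow>\<^sub>0 nat) set"
  assumes "finite B"
  defines "E \<equiv> exponent_power (B + UNIV)"
  shows "saturation_degree_int B (int k) j \<longleftrightarrow> j \<in> int ` total_degree ` (exponent_saturation (E k) - E k)"
proof -
  let ?vec = "\<lambda>m::'n \<Rightarrow>\<^sub>0 nat. \<lambda>i. int (Poly_Mapping.lookup m i)"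
  have ex: "(\<exists>u. (\<forall>i. 0 \<le> u i) \<and> P u) \<longleftrightarrow> (\<exists>m. P (?vec m))" for P
  proof
    assume "\<exists>u. (\<forall>i. 0 \<le> u i) \<and> P u"
    then obtain u where u: "\<forall>i. 0 \<le> u i" "P u" by blast
    from u(1) obtain m where "u = ?vec m" by (rule nonneg_vector_exponent)
    then show "\<exists>m. P (?vec m)" using u(2) by blast
  next
    assume "\<exists>m. P (?vec m)"
    then obtain m where "P (?vec m)" by blast
    then show "\<exists>u. (\<forall>i. 0 \<le> u i) \<and> P u" by (intro exI[of _ "?vec m"]) simp
  qed
  have all: "(\<forall>u. (\<forall>i. 0 \<le> u i) \<and> Q u \<longrightarrow> P u) \<longleftrightarrow> (\<forall>m. Q (?vec m) \<longrightarrow> P (?vec m))" for P Q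
    using ex[of "\<lambda>u. Q u \<and> \<not> P u"] by blast
  have add: "?vec m + ?vec v = ?vec (m + v)" for m v by (auto simp: lookup_add)
  have mem: "exponent_power_int B (int k) (?vec m) \<longleftrightarrow> m \<in> E k" for m
    unfolding E_def by (rule exponent_power_int_iff[OF assms(1)])
  have sat: "(\<exists>t. \<forall>v. t \<le> int (total_degree v) \<longrightarrow> m + v \<in> E k) \<longleftrightarrow> m \<in> exponent_saturation (E k)" for m
  proof
    assume "\<exists>t. \<forall>v. t \<le> int (total_degree v) \<longrightarrow> m + v \<in> E k"
    then obtain t where "\<And>v. t \<le> int (total_degree v) \<Longrightarrow> m + v \<in> E k" by blast
    then have "\<forall>v. nat t \<le> total_degree v \<longrightarrow> m + v \<in> E k" by simp
    then show "m \<in> exponent_saturation (E k)" unfolding exponent_saturation_def by blast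
  next
    assume "m \<in> exponent_saturation (E k)"
    then obtain t where "\<And>v. t \<le> total_degree v \<Longrightarrow> m + v \<in> E k"
      unfolding exponent_saturation_def by blast
    then show "\<exists>t. \<forall>v. t \<le> int (total_degree v) \<longrightarrow> m + v \<in> E k"
      by (intro exI[of _ "int t"]) simp
  qed
  show ?thesis
    unfolding saturation_degree_int_def ex all add mem int_total_degree sat by auto
qed

section \<open>The graph of the spread and the conclusion\<close>

text \<open>The predicate is the graph of \<open>sigma\<close> expressed by the set of degrees:
  \<open>a\<close> and \<open>b\<close> are its extremes, and the empty set stands for the zero
  module.\<close>

lemma presburger_spread:
  assumes "presburger (\<lambda>e. D (fst e) (snd e))"
  shows "presburger (\<lambda>p::int \<times> int. ((\<forall>j. \<not> D (fst p) j) \<and> snd p = 0) \<or>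
    (\<exists>a b. D (fst p) a \<and> D (fst p) b \<and> b - a + 1 = snd p \<and> (\<forall>j. D (fst p) j \<longrightarrow> a \<le> j \<and> j \<le> b)))"
proof -
  have D: "presburger (\<lambda>e. D (f e) (g e))" if "additive f" "additive g"
    for f g :: "'e::ab_group_add \<Rightarrow> int"
    using presburger_pullback[OF assms, of "\<lambda>e. (f e, g e)"] that by (simp add: additive_def)
  \<comment> \<open>This brings the equation into the shape of \<open>presburger_eq\<close>.\<close>
  have eq: "b - a + 1 = z \<longleftrightarrow> z = b - a + 1" for a b z :: int by auto
  show ?thesis
    unfolding eq
    by (intro presburger_disj presburger.conj presburger_all presburger_ex presburger_imp D
        presburger_le_0 presburger_eq_0 presburger_eq presburger.neg)
      (simp_all add: additive_def algebra_simps)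
qed

theorem theorem1p7:
  fixes I :: "('n::finite, 'k::field) polyring set"
  assumes "monomial_ideal I"
  shows "\<exists>f :: int \<Rightarrow> int. quasi_linear f \<and>
    (\<forall>\<^sub>F k in sequentially.
       sigma (saturation (ideal_power I k)) (ideal_power I k) = f (int k))"
proof -
  obtain M where "I = ideal.span (monom_of ` M)"
    using assms unfolding monomial_ideal_def by blast
  then have "I = supported_in (M + UNIV)" by (simp add: span_monom_of)
  moreover obtain B where B: "finite B" "M + UNIV = B + UNIV"
    using up_closed_finite_basis[OF up_closed_plus[OF up_closed_UNIV]] by blast
  ultimately have I: "I = supported_in (B + UNIV)" by simp
  define E where "E = exponent_power (B + UNIV)"
  have up: "up_closed (B + UNIV)" by (intro up_closed_plus up_closed_UNIV)
  have upE: "up_closed (E k)" for k unfolding E_def by (intro up_closed_exponent_power up)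
  define s where "s k = sigma (saturation (ideal_power I k)) (ideal_power I k)" for k
  let ?D = "saturation_degree_int B"
  define degs where "degs k = total_degree ` (exponent_saturation (E k) - E k)" for k
  have s: "s k = (if degs k = {} then 0 else int (Max (degs k)) - int (Min (degs k)) + 1)" for k
    unfolding s_def I ideal_power_supported_in[OF up] saturation_supported_in
      sigma_supported_in[OF upE[unfolded E_def]] degs_def E_def ..
  have D: "?D (int k) j \<longleftrightarrow> j \<in> int ` degs k" for k j
    unfolding degs_def E_def by (rule saturation_degree_int_iff[OF B(1)])
  have fin: "finite (degs k)" for k
    unfolding degs_def by (rule finite_degrees_saturation[OF upE])
  have graph: "((\<forall>j. \<not> ?D (int k) j) \<and> z = 0) \<or> (\<exists>a b. ?D (int k) a \<and> ?D (int k) b \<and> b - a + 1 = z \<and>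
      (\<forall>j. ?D (int k) j \<longrightarrow> a \<le> j \<and> j \<le> b)) \<longleftrightarrow> z = s k" for k z
  proof (cases "degs k = {}")
    case True
    then show ?thesis by (simp add: D s)
  next
    case False
    have extremes: "Min (degs k) \<in> degs k" "Max (degs k) \<in> degs k"
      "\<And>j. j \<in> degs k \<Longrightarrow> Min (degs k) \<le> j \<and> j \<le> Max (degs k)"
      using fin False by simp_all
    have nonempty: "\<not> (\<forall>j. \<not> ?D (int k) j)" using extremes(1) by (auto simp: D)
    show ?thesis
    proof
      assume "z = s k"
      then show "((\<forall>j. \<not> ?D (int k) j) \<and> z = 0) \<or> (\<exists>a b. ?D (int k) a \<and> ?D (int k) b \<and>
          b - a + 1 = z \<and> (\<forall>j. ?D (int k) j \<longrightarrow> a \<le> j \<and> j \<le> b))"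
        using extremes False
        by (intro disjI2 exI[of _ "int (Min (degs k))"] exI[of _ "int (Max (degs k))"]) (auto simp: D s)
    next
      assume "((\<forall>j. \<not> ?D (int k) j) \<and> z = 0) \<or> (\<exists>a b. ?D (int k) a \<and> ?D (int k) b \<and>
          b - a + 1 = z \<and> (\<forall>j. ?D (int k) j \<longrightarrow> a \<le> j \<and> j \<le> b))"
      then obtain a b where ab: "?D (int k) a" "?D (int k) b" "b - a + 1 = z"
        "\<And>j. ?D (int k) j \<Longrightarrow> a \<le> j \<and> j \<le> b" using nonempty by blast
      obtain m n where mn: "a = int m" "b = int n" "m \<in> degs k" "n \<in> degs k"
        using ab(1,2) by (auto simp: D)
      have "m \<le> j \<and> j \<le> n" if "j \<in> degs k" for j
        using ab(4)[of "int j"] that by (simp add: D mn)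
      then have "Min (degs k) = m" "Max (degs k) = n"
        using mn fin by (auto intro!: Min_eqI Max_eqI)
      then show "z = s k" using ab(3) False by (simp add: s mn)
    qed
  qed
  show ?thesis
    using presburger_function_quasi_linear[OF presburger_spread
        [OF presburger_saturation_degree_int[OF B(1)]], of s] graph
    unfolding s_def by blast
qed

end
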